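(* Suppose $\sigma\colon X\to B_E$ is an uncollapsed uniformly continuous map from a Banach space $X$ into the unit ball $B_E$ of a Banach space $E$. Then $X$ admits a uniformly continuous coarse embedding into $E\oplus E$.
   Context: For a map $\sigma\colon (X,d)\to (Y,\partial)$ between metric spaces put $\kappa_\sigma(t)=\inf\{\partial(\sigma(a),\sigma(b)) : d(a,b)\geqslant t\}$ (compression modulus) and $\theta_\sigma(t)=\sup\{\partial(\sigma(a),\sigma(b)) : d(a,b)\leqslant t\}$ (expansion modulus). The map $\sigma$ is uniformly continuous if $\lim_{t\to 0_+}\theta_\sigma(t)=0$; bornologous if $\theta_\sigma(t)<\infty$ for all $t<\infty$; expanding if $\lim_{t\to\infty}\kappa_\sigma(t)=\infty$; a coarse embedding if it is bornologous and expanding; uncollapsed if $\kappa_\sigma(t)>0$ for some $t>0$. Banach spaces carry their norm metric. *)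

theory Defs
  imports "HOL-Analysis.Analysis"
begin

text \<open>
  Both moduli take values in \<open>[0, \<infinity>]\<close>. In particular the infimum over an empty set of pairs
  is \<open>\<infinity>\<close>, which is what happens for large \<open>t\<close> when the domain is bounded.
\<close>

definition compression_modulus ::
  "('a::metric_space \<Rightarrow> 'b::metric_space) \<Rightarrow> real \<Rightarrow> ennreal" where
  "compression_modulus \<sigma> t = Inf {ennreal (dist (\<sigma> a) (\<sigma> b)) | a b. dist a b \<ge> t}"

definition expansion_modulus ::
  "('a::metric_space \<Rightarrow> 'b::metric_space) \<Rightarrow> real \<Rightarrow> ennreal" where
  "expansion_modulus \<sigma> t = Sup {ennreal (dist (\<sigma> a) (\<sigma> b)) | a b. dist a b \<le> t}"

definition bornologous :: "('a::metric_space \<Rightarrow> 'b::metric_space) \<Rightarrow> bool" where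
  "bornologous \<sigma> \<longleftrightarrow> (\<forall>t. expansion_modulus \<sigma> t < \<infinity>)"

definition expanding :: "('a::metric_space \<Rightarrow> 'b::metric_space) \<Rightarrow> bool" where
  "expanding \<sigma> \<longleftrightarrow> (compression_modulus \<sigma> \<longlongrightarrow> \<infinity>) at_top"

definition coarse_embedding :: "('a::metric_space \<Rightarrow> 'b::metric_space) \<Rightarrow> bool" where
  "coarse_embedding \<sigma> \<longleftrightarrow> bornologous \<sigma> \<and> expanding \<sigma>"

definition uncollapsed :: "('a::metric_space \<Rightarrow> 'b::metric_space) \<Rightarrow> bool" where
  "uncollapsed \<sigma> \<longleftrightarrow> (\<exists>t>0. compression_modulus \<sigma> t > 0)"

text \<open>
  Uniform continuity is the library notion; it agrees with the description by the
  expansion modulus.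
\<close>

lemma uniformly_continuous_on_UNIV_iff_expansion_modulus:
  fixes \<sigma> :: "'a::metric_space \<Rightarrow> 'b::metric_space"
  shows "uniformly_continuous_on UNIV \<sigma> \<longleftrightarrow> (expansion_modulus \<sigma> \<longlongrightarrow> 0) (at_right 0)"
proof
  assume uc: "uniformly_continuous_on UNIV \<sigma>"
  show "(expansion_modulus \<sigma> \<longlongrightarrow> 0) (at_right 0)"
  proof (rule order_tendstoI)
    fix c :: ennreal assume "c < 0"
    then show "\<forall>\<^sub>F t in at_right 0. c < expansion_modulus \<sigma> t" by simp
  next
    fix c :: ennreal assume "0 < c"
    then obtain e where e: "0 < e" "e < c" using dense by blast
    then obtain r where r: "e = ennreal r" "0 < r"
      by (cases e) (auto simp: top_unique dest: less_le_trans)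
    obtain d where d: "d > 0" "\<And>x y. dist x y < d \<Longrightarrow> dist (\<sigma> x) (\<sigma> y) < r"
      using uc r(2) unfolding uniformly_continuous_on_def by (metis UNIV_I)
    have "expansion_modulus \<sigma> t < c" if "t < d" for t
    proof -
      have "expansion_modulus \<sigma> t \<le> e"
        unfolding expansion_modulus_def
      proof (rule Sup_least)
        fix z assume "z \<in> {ennreal (dist (\<sigma> a) (\<sigma> b)) | a b. dist a b \<le> t}"
        then obtain a b where ab: "z = ennreal (dist (\<sigma> a) (\<sigma> b))" "dist a b \<le> t" by blast
        have "dist (\<sigma> a) (\<sigma> b) < r" using d(2) ab(2) that by simp
        then show "z \<le> e" by (simp add: ab(1) r(1) ennreal_leI)
      qed
      then show ?thesis using e(2) by simp
    qed
    then show "\<forall>\<^sub>F t in at_right 0. expansion_modulus \<sigma> t < c"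
      using d(1) by (auto simp: eventually_at_right_field)
  qed
next
  assume lim: "(expansion_modulus \<sigma> \<longlongrightarrow> 0) (at_right 0)"
  show "uniformly_continuous_on UNIV \<sigma>"
    unfolding uniformly_continuous_on_def
  proof (intro allI impI)
    fix e :: real assume e: "e > 0"
    then have "\<forall>\<^sub>F t in at_right 0. expansion_modulus \<sigma> t < ennreal e"
      using order_tendstoD(2)[OF lim] by simp
    then obtain b where b: "b > 0" "\<And>t. 0 < t \<Longrightarrow> t < b \<Longrightarrow> expansion_modulus \<sigma> t < ennreal e"
      by (auto simp: eventually_at_right_field)
    have "dist (\<sigma> x') (\<sigma> x) < e" if "dist x' x < b / 2" for x x'
    proof -
      have "ennreal (dist (\<sigma> x') (\<sigma> x)) \<le> expansion_modulus \<sigma> (b / 2)"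
        unfolding expansion_modulus_def using that by (intro Sup_upper CollectI exI conjI) auto
      also have "\<dots> < ennreal e" using b by simp
      finally show ?thesis by (simp add: ennreal_less_iff)
    qed
    then show "\<exists>d>0. \<forall>x\<in>UNIV. \<forall>x'\<in>UNIV. dist x' x < d \<longrightarrow> dist (\<sigma> x') (\<sigma> x) < e"
      using b(1) by (meson half_gt_zero)
  qed
qed

end

theory Submission
  imports Defs
begin

text \<open>
  Superimpose rescaled copies of \<open>\<sigma>\<close>: the \<open>m\<close>-th copy is \<open>K ^ m *\<^sub>R \<sigma> (x / R m)\<close> with \<open>K\<close> so large
  that the separation \<open>K ^ m * \<delta>\<close> which it provides at distances at least \<open>t * R m\<close> beats the total
  diameter of all earlier copies, and with \<open>R m\<close> growing so fast that at small distances all later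
  copies are negligible. Only distances slightly below \<open>t * R (m + 1)\<close> are problematic, since
  there copy \<open>m + 1\<close> may cancel copy \<open>m\<close>. Putting the even copies into the first and the odd copies
  into the second summand of \<open>E \<oplus> E\<close> removes this interference.
\<close>

section \<open>Metric criteria for the conditions on the moduli\<close>

lemma bornologousI:
  fixes f :: "'a::metric_space \<Rightarrow> 'b::metric_space"
  assumes "\<And>t. \<exists>M. \<forall>a b. dist a b \<le> t \<longrightarrow> dist (f a) (f b) \<le> M"
  shows "bornologous f"
  unfolding bornologous_def
proof
  fix t
  obtain M where M: "\<And>a b. dist a b \<le> t \<Longrightarrow> dist (f a) (f b) \<le> M"
    using assms by blast
  have "expansion_modulus f t \<le> ennreal M"
    unfolding expansion_modulus_def by (rule Sup_least) (auto intro!: ennreal_leI M)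
  then show "expansion_modulus f t < \<infinity>"
    by (simp add: le_less_trans)
qed

lemma expandingI:
  fixes f :: "'a::metric_space \<Rightarrow> 'b::metric_space"
  assumes "\<And>M. \<exists>t. \<forall>a b. t \<le> dist a b \<longrightarrow> M \<le> dist (f a) (f b)"
  shows "expanding f"
  unfolding expanding_def infinity_ennreal_def
proof (rule order_tendstoI)
  fix c :: ennreal assume "c < top"
  then obtain r where r: "c = ennreal r" "0 \<le> r"
    by (cases c) auto
  obtain t where t: "\<And>a b. t \<le> dist a b \<Longrightarrow> r + 1 \<le> dist (f a) (f b)"
    using assms by blast
  have "c < compression_modulus f s" if "t \<le> s" for s
  proof -
    have "ennreal (r + 1) \<le> compression_modulus f s"
      unfolding compression_modulus_def
      by (rule Inf_greatest) (use t that in \<open>auto intro!: ennreal_leI dest: order_trans\<close>)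
    moreover have "c < ennreal (r + 1)"
      using r by (simp add: ennreal_less_iff)
    ultimately show ?thesis
      by (rule less_le_trans[rotated])
  qed
  then show "\<forall>\<^sub>F s in at_top. c < compression_modulus f s"
    by (auto simp: eventually_at_top_linorder)
qed simp

lemma uncollapsedE:
  fixes f :: "'a::metric_space \<Rightarrow> 'b::metric_space"
  assumes "uncollapsed f"
  obtains t \<delta> where "1 \<le> t" "0 < \<delta>" "\<And>a b. t \<le> dist a b \<Longrightarrow> \<delta> \<le> dist (f a) (f b)"
proof -
  obtain t where t: "0 < t" "0 < compression_modulus f t"
    using assms unfolding uncollapsed_def by blast
  \<comment> \<open>The modulus may be infinite, so a value strictly below it is taken to get a real
    \<open>\<delta>\<close>.\<close>
  obtain c where c: "0 < c" "c < compression_modulus f t"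
    using dense[OF t(2)] by blast
  then obtain \<delta> where \<delta>: "c = ennreal \<delta>" "0 < \<delta>"
    by (cases c) (auto simp: ennreal_zero_less_top)
  show thesis
  proof (rule that[of "max 1 t" \<delta>])
    fix a b :: 'a assume "max 1 t \<le> dist a b"
    then have "compression_modulus f t \<le> ennreal (dist (f a) (f b))"
      unfolding compression_modulus_def by (intro Inf_lower) auto
    then have "ennreal \<delta> < ennreal (dist (f a) (f b))"
      using c(2) \<delta>(1) by auto
    then show "\<delta> \<le> dist (f a) (f b)"
      using \<delta>(2) by (simp add: ennreal_less_iff)
  qed (use \<delta> in auto)
qed

section \<open>Maps into a product\<close>

lemma dist_Pair_le:
  fixes a c :: "'a::metric_space" and b d :: "'b::metric_space"
  shows "dist (a, b) (c, d) \<le> dist a c + dist b d"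
  unfolding dist_Pair_Pair by (rule sqrt_sum_squares_le_sum) auto

lemma uniformly_continuous_on_Pair:
  fixes f :: "'a::metric_space \<Rightarrow> 'b::metric_space" and g :: "'a \<Rightarrow> 'c::metric_space"
  assumes "uniformly_continuous_on S f" "uniformly_continuous_on S g"
  shows "uniformly_continuous_on S (\<lambda>x. (f x, g x))"
  unfolding uniformly_continuous_on_def
proof (intro allI impI)
  fix e :: real assume e: "0 < e"
  obtain d1 where d1: "0 < d1" "\<And>x y. x \<in> S \<Longrightarrow> y \<in> S \<Longrightarrow> dist y x < d1 \<Longrightarrow> dist (f y) (f x) < e / 2"
    using assms(1) e unfolding uniformly_continuous_on_def by (metis half_gt_zero)
  obtain d2 where d2: "0 < d2" "\<And>x y. x \<in> S \<Longrightarrow> y \<in> S \<Longrightarrow> dist y x < d2 \<Longrightarrow> dist (g y) (g x) < e / 2"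
    using assms(2) e unfolding uniformly_continuous_on_def by (metis half_gt_zero)
  have "dist (f y, g y) (f x, g x) < e" if "x \<in> S" "y \<in> S" "dist y x < min d1 d2" for x y
    using d1(2)[of x y] d2(2)[of x y] that dist_Pair_le[of "f y" "g y" "f x" "g x"] by simp
  then show "\<exists>d>0. \<forall>x\<in>S. \<forall>y\<in>S. dist y x < d \<longrightarrow> dist (f y, g y) (f x, g x) < e"
    using d1(1) d2(1) by (intro exI[of _ "min d1 d2"]) auto
qed

section \<open>Sums of maps acting at growing scales\<close>

text \<open>Only differences are controlled: \<open>C n\<close> caps how much the
  \<open>n\<close>-th map can disturb the others, while \<open>L n\<close> is the range within which
  it is negligible, with errors summable over \<open>n\<close>.\<close>

locale multiscale =
  fixes f :: "nat \<Rightarrow> 'x::real_normed_vector \<Rightarrow> 'e::banach" and C L :: "nat \<Rightarrow> real"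
  assumes diff_le: "norm (f n a - f n b) \<le> C n"
    and small_diff: "dist a b \<le> L n \<Longrightarrow> norm (f n a - f n b) \<le> (1/2) ^ n"
    and uniformly_continuous: "uniformly_continuous_on UNIV (f n)"
    and incseq_L: "incseq L"
    and L_at_top: "filterlim L at_top sequentially"
begin

text \<open>The values \<open>f n x\<close> themselves need not be summable. Subtracting
  \<open>f n 0\<close> gives convergence and cancels in differences of \<open>total\<close>.\<close>

definition total :: "'x \<Rightarrow> 'e" where
  "total x = (\<Sum>n. f n x - f n 0)"

lemma L_exceeds: obtains N where "k \<le> N" "t \<le> L N"
proof -
  have "\<forall>\<^sub>F n in sequentially. t \<le> L n \<and> k \<le> n"
    using L_at_top eventually_ge_at_top[of k] unfolding filterlim_at_top
    by (auto intro: eventually_conj)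
  then show thesis
    using that by (auto simp: eventually_sequentially)
qed

lemma small_diff_tail:
  assumes "dist a b \<le> L N"
  shows "norm (f (n + N) a - f (n + N) b) \<le> (1/2) ^ N * (1/2) ^ n"
proof -
  have "L N \<le> L (n + N)"
    using incseq_L by (simp add: incseq_def)
  then show ?thesis
    using small_diff[of a b "n + N"] assms by (simp add: power_add mult.commute)
qed

lemma summable_diff: "summable (\<lambda>n. f n a - f n b)"
proof -
  obtain N where N: "dist a b \<le> L N"
    by (rule L_exceeds)
  have "summable (\<lambda>n. f (n + N) a - f (n + N) b)"
    by (rule summable_comparison_test'[where N = 0 and g = "\<lambda>n. (1/2) ^ N * (1/2) ^ n"])
       (use small_diff_tail[OF N] in \<open>auto intro!: summable_mult summable_geometric\<close>)
  then show ?thesis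
    by (subst summable_iff_shift[symmetric])
qed

lemma total_diff: "total a - total b = (\<Sum>n. f n a - f n b)"
  unfolding total_def by (subst suminf_diff[OF summable_diff summable_diff]) simp

text \<open>Within distance \<open>L N\<close> the terms from \<open>N\<close> on are dominated by a
  geometric series, uniformly in \<open>a\<close> and \<open>b\<close>. All estimates on
  \<open>total\<close> thereby reduce to finite sums.\<close>

lemma norm_total_diff_approx:
  assumes "dist a b \<le> L N"
  shows "norm (total a - total b - (\<Sum>n<N. f n a - f n b)) \<le> 2 * (1/2) ^ N"
proof -
  have "total a - total b - (\<Sum>n<N. f n a - f n b) = (\<Sum>n. f (n + N) a - f (n + N) b)"
    unfolding total_diff using suminf_split_initial_segment[OF summable_diff, of a b N] by simp
  also have "norm \<dots> \<le> (\<Sum>n. (1/2) ^ N * (1/2) ^ n)"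
    by (rule norm_suminf_le[OF small_diff_tail[OF assms]])
       (intro summable_mult summable_geometric, simp)
  also have "\<dots> = 2 * (1/2) ^ N"
    by (subst suminf_mult) (auto simp: suminf_geometric intro: summable_geometric)
  finally show ?thesis .
qed

lemma total_bounded_on_scale:
  "\<exists>M. \<forall>a b. dist a b \<le> t \<longrightarrow> dist (total a) (total b) \<le> M"
proof -
  obtain N where N: "t \<le> L N"
    by (rule L_exceeds)
  have "dist (total a) (total b) \<le> (\<Sum>n<N. C n) + 2 * (1/2) ^ N" if "dist a b \<le> t" for a b
  proof -
    have "norm (\<Sum>n<N. f n a - f n b) \<le> (\<Sum>n<N. C n)"
      by (rule sum_norm_le) (rule diff_le)
    moreover have "norm (total a - total b - (\<Sum>n<N. f n a - f n b)) \<le> 2 * (1/2) ^ N"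
      using N that by (intro norm_total_diff_approx) simp
    ultimately show ?thesis
      unfolding dist_norm by norm
  qed
  then show ?thesis by blast
qed

lemma uniformly_continuous_total: "uniformly_continuous_on UNIV total"
  unfolding uniformly_continuous_on_def
proof (intro allI impI)
  fix e :: real assume e: "0 < e"
  obtain k where k: "(1/2::real) ^ k < e / 4"
    using real_arch_pow_inv[of "e / 4" "1/2"] e by auto
  \<comment> \<open>One \<open>N\<close> then serves all pairs at distance at most 1, whence
    \<open>min d 1\<close> below.\<close>
  obtain N where N: "k \<le> N" "1 \<le> L N"
    by (rule L_exceeds)
  have "(1/2::real) ^ N \<le> (1/2) ^ k"
    using N(1) by (intro power_decreasing) auto
  with k have tail: "2 * (1/2::real) ^ N < e / 2"
    by linarith
  have "uniformly_continuous_on UNIV (\<lambda>x. \<Sum>n<N. f n x)"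
    by (induction N) (auto intro!: uniformly_continuous_on_add uniformly_continuous
        simp: uniformly_continuous_on_const)
  then obtain d where d: "0 < d"
    and sum: "\<And>a b. dist a b < d \<Longrightarrow> dist (\<Sum>n<N. f n a) (\<Sum>n<N. f n b) < e / 2"
    using e unfolding uniformly_continuous_on_def by (metis UNIV_I half_gt_zero)
  have "dist (total a) (total b) < e" if "dist a b < min d 1" for a b
  proof -
    have "norm (\<Sum>n<N. f n a - f n b) < e / 2"
      using sum[of a b] that by (simp add: dist_norm sum_subtractf)
    moreover have "norm (total a - total b - (\<Sum>n<N. f n a - f n b)) \<le> 2 * (1/2) ^ N"
      using N that by (intro norm_total_diff_approx) simp
    ultimately show ?thesis
      using tail unfolding dist_norm by norm
  qed
  then show "\<exists>d>0. \<forall>x\<in>UNIV. \<forall>x'\<in>UNIV. dist x' x < d \<longrightarrow> dist (total x') (total x) < e"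
    using d by (intro exI[of _ "min d 1"]) auto
qed

text \<open>With map \<open>Suc m\<close> silent on this pair, map \<open>m\<close> competes only
  with the earlier maps, bounded by the sum of \<open>C n\<close>, and with a tail of size at most
  1.\<close>

lemma norm_total_diff_ge:
  assumes "dist a b \<le> L (m + 2)" and "f (Suc m) a = f (Suc m) b"
  shows "norm (f m a - f m b) - (\<Sum>n<m. C n) - 1 \<le> dist (total a) (total b)"
proof -
  let ?s = "\<Sum>n<m. f n a - f n b"
  have "norm ?s \<le> (\<Sum>n<m. C n)"
    by (rule sum_norm_le) (rule diff_le)
  moreover have "(\<Sum>n<m + 2. f n a - f n b) = ?s + (f m a - f m b)"
    using assms(2) by simp
  then have "norm (total a - total b - (?s + (f m a - f m b))) \<le> 2 * (1/2) ^ (m + 2)"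
    using norm_total_diff_approx[OF assms(1)] by simp
  then have "norm (total a - total b - (?s + (f m a - f m b))) \<le> 1"
    using power_le_one[of "1/2::real" m] by simp
  ultimately show ?thesis
    unfolding dist_norm by norm
qed

end

section \<open>Splitting the scales by parity\<close>

lemma multiscale_restrict:
  assumes "multiscale f C L"
  shows "multiscale (\<lambda>n. if P n then f n else (\<lambda>_. 0)) C L"
proof -
  interpret multiscale f C L by fact
  have "0 \<le> C n" for n
    using diff_le[of n 0 0] by simp
  then show ?thesis
    using diff_le small_diff uniformly_continuous incseq_L L_at_top
    by unfold_locales (auto simp: uniformly_continuous_on_const)
qed

text \<open>
  Here \<open>T m\<close> is the distance at which \<open>f m\<close> starts to separate points; the assumption \<open>T m \<le> L (Suc m)\<close> says
  that at this distance \<open>f (Suc m)\<close> is still negligible.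
\<close>

lemma multiscale_coarse_embedding:
  fixes f :: "nat \<Rightarrow> 'x::real_normed_vector \<Rightarrow> 'e::banach"
  assumes "multiscale f C L"
    and sep: "\<And>m a b. T m \<le> dist a b \<Longrightarrow> D m \<le> norm (f m a - f m b) - (\<Sum>n<m. C n)"
    and D: "filterlim D at_top sequentially"
    and T: "filterlim T at_top sequentially"
    and TL: "\<And>m. T m \<le> L (Suc m)"
  shows "\<exists>\<phi> :: 'x \<Rightarrow> 'e \<times> 'e. uniformly_continuous_on UNIV \<phi> \<and> coarse_embedding \<phi>"
proof -
  let ?f = "\<lambda>P n. if P n then f n else (\<lambda>_. 0)"
  interpret ev: multiscale "?f even" C L by (rule multiscale_restrict[OF assms(1)])
  interpret od: multiscale "?f odd" C L by (rule multiscale_restrict[OF assms(1)])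
  define \<phi> where "\<phi> = (\<lambda>x. (ev.total x, od.total x))"
  have "uniformly_continuous_on UNIV \<phi>"
    unfolding \<phi>_def by (rule uniformly_continuous_on_Pair[OF
        ev.uniformly_continuous_total od.uniformly_continuous_total])
  moreover have "bornologous \<phi>"
  proof (rule bornologousI)
    fix t
    obtain M1 where M1: "\<And>a b. dist a b \<le> t \<Longrightarrow> dist (ev.total a) (ev.total b) \<le> M1"
      using ev.total_bounded_on_scale by blast
    obtain M2 where M2: "\<And>a b. dist a b \<le> t \<Longrightarrow> dist (od.total a) (od.total b) \<le> M2"
      using od.total_bounded_on_scale by blast
    have "dist (\<phi> a) (\<phi> b) \<le> M1 + M2" if "dist a b \<le> t" for a b
      unfolding \<phi>_def by (rule order_trans[OF dist_Pair_le add_mono]) (use M1 M2 that in auto)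
    then show "\<exists>M. \<forall>a b. dist a b \<le> t \<longrightarrow> dist (\<phi> a) (\<phi> b) \<le> M" by blast
  qed
  moreover have "expanding \<phi>"
  proof (rule expandingI)
    fix M
    obtain m0 where m0: "\<And>m. m0 \<le> m \<Longrightarrow> M + 1 \<le> D m"
      using D unfolding filterlim_at_top eventually_sequentially by blast
    have "M \<le> dist (\<phi> a) (\<phi> b)" if ab: "T m0 \<le> dist a b" for a b
    proof -
      obtain N where N: "\<And>n. N \<le> n \<Longrightarrow> dist a b + 1 \<le> T n"
        using T unfolding filterlim_at_top eventually_sequentially by blast
      \<comment> \<open>The last scale active at this distance. Maximality puts
        \<open>dist a b\<close> below \<open>T (Suc m)\<close>, hence below
        \<open>L (m + 2)\<close>, and \<open>m0 \<le> m\<close> makes \<open>D m\<close>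
        large.\<close>
      define m where "m = (GREATEST n. T n \<le> dist a b)"
      have bound: "n \<le> N" if "T n \<le> dist a b" for n
        using N[of n] that by (cases "n \<le> N") auto
      have m: "T m \<le> dist a b"
        unfolding m_def by (rule GreatestI_nat[where P = "\<lambda>n. T n \<le> dist a b" and b = N, OF ab bound])
      have le_m: "n \<le> m" if "T n \<le> dist a b" for n
        unfolding m_def by (rule Greatest_le_nat[where P = "\<lambda>n. T n \<le> dist a b" and b = N, OF that bound])
      have "\<not> T (Suc m) \<le> dist a b"
        using le_m[of "Suc m"] by auto
      then have L: "dist a b \<le> L (m + 2)"
        using TL[of "Suc m"] by simp
      \<comment> \<open>The extra 1 pays for the tail in \<open>norm_total_diff_ge\<close>.\<close>
      have D: "M + 1 \<le> norm (f m a - f m b) - (\<Sum>n<m. C n)"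
        using sep[OF m] m0[OF le_m[OF ab]] by simp
      show ?thesis
      proof (cases "even m")
        \<comment> \<open>As \<open>Suc m\<close> is odd, its map is zero in the even family, so
          nothing can cancel map \<open>m\<close> there.\<close>
        case True
        then have "M \<le> dist (ev.total a) (ev.total b)"
          using ev.norm_total_diff_ge[OF L] D by simp
        then show ?thesis
          using dist_fst_le[of "\<phi> a" "\<phi> b"] by (simp add: \<phi>_def)
      next
        case False
        then have "M \<le> dist (od.total a) (od.total b)"
          using od.norm_total_diff_ge[OF L] D by simp
        then show ?thesis
          using dist_snd_le[of "\<phi> a" "\<phi> b"] by (simp add: \<phi>_def)
      qed
    qed
    then show "\<exists>t. \<forall>a b. t \<le> dist a b \<longrightarrow> M \<le> dist (\<phi> a) (\<phi> b)" by blast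
  qed
  ultimately show ?thesis
    unfolding coarse_embedding_def by blast
qed

section \<open>Choice of amplitudes and scales for the copies of \<open>\<sigma>\<close>\<close>

theorem theorem3:
  fixes \<sigma> :: "'x::banach \<Rightarrow> 'e::banach"
  assumes "range \<sigma> \<subseteq> cball 0 1"
    and "uniformly_continuous_on UNIV \<sigma>"
    and "uncollapsed \<sigma>"
  shows "\<exists>\<phi> :: 'x \<Rightarrow> 'e \<times> 'e. uniformly_continuous_on UNIV \<phi> \<and> coarse_embedding \<phi>"
proof -
  obtain t \<delta> where t: "1 \<le> t" and \<delta>: "0 < \<delta>"
    and sep: "\<And>a b. t \<le> dist a b \<Longrightarrow> \<delta> \<le> dist (\<sigma> a) (\<sigma> b)"
    using uncollapsedE[OF assms(3)] by blast
  \<comment> \<open>Since \<open>K - 1 = 4 / \<delta>\<close>, the bounds \<open>2 * K ^ n\<close>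
    for \<open>n < m\<close> add up to less than half of the separation
    \<open>K ^ m * \<delta>\<close>.\<close>
  define K where "K = 1 + 4 / \<delta>"
  have K: "1 < K"
    using \<delta> by (simp add: K_def)
  \<comment> \<open>Dividing by \<open>K ^ n\<close> offsets the later amplification of copy
    \<open>n\<close>.\<close>
  have "\<exists>\<eta>. 0 < \<eta> \<and> \<eta> \<le> 1 \<and> (\<forall>a b. dist a b \<le> \<eta> \<longrightarrow> dist (\<sigma> a) (\<sigma> b) \<le> (1/2) ^ n / K ^ n)" for n
  proof -
    have "0 < (1/2) ^ n / K ^ n"
      using K by simp
    then obtain d where "0 < d" "\<And>a b. dist a b < d \<Longrightarrow> dist (\<sigma> a) (\<sigma> b) < (1/2) ^ n / K ^ n"
      using assms(2) unfolding uniformly_continuous_on_def by (metis UNIV_I)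
    then show ?thesis
      by (intro exI[of _ "min 1 (d / 2)"]) (auto simp: min_def split: if_splits intro!: less_imp_le)
  qed
  then obtain \<eta> where \<eta>: "\<And>n. 0 < \<eta> n" "\<And>n. \<eta> n \<le> 1"
    and small: "\<And>n a b. dist a b \<le> \<eta> n \<Longrightarrow> dist (\<sigma> a) (\<sigma> b) \<le> (1/2) ^ n / K ^ n"
    by metis
  \<comment> \<open>Chosen so that \<open>L (Suc n)\<close> becomes exactly the maximum:
    \<open>real n\<close> drives \<open>L\<close> to infinity, and \<open>t * R n\<close> keeps copy
    \<open>Suc n\<close> negligible up to the distance where copy \<open>n\<close> starts to
    separate.\<close>
  define R where "R = rec_nat 1 (\<lambda>n r. max (real n) (t * r) / \<eta> (Suc n))"
  have R_Suc: "R (Suc n) = max (real n) (t * R n) / \<eta> (Suc n)" for n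
    by (simp add: R_def)
  have R: "0 < R n" for n
  proof (induction n)
    case (Suc n)
    then have "0 < t * R n"
      using t by simp
    then show ?case
      using \<eta>(1)[of "Suc n"] by (simp add: R_Suc less_max_iff_disj)
  qed (simp add: R_def)
  define L where "L n = R n * \<eta> n" for n
  have L_Suc: "L (Suc n) = max (real n) (t * R n)" for n
    using \<eta>(1)[of "Suc n"] by (simp add: L_def R_Suc)
  \<comment> \<open>Here \<open>\<eta> n \<le> 1 \<le> t\<close> enters. As
    \<open>t * R n \<le> L (Suc n)\<close>, this yields both monotonicity of \<open>L\<close> and
    divergence of \<open>t * R n\<close>.\<close>
  have LT: "L n \<le> t * R n" for n
  proof -
    have "R n * \<eta> n \<le> R n * t"
      using \<eta>(2)[of n] t R[of n] by (intro mult_left_mono) auto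
    then show ?thesis
      by (simp add: L_def mult.commute)
  qed
  have L_top: "filterlim L at_top sequentially"
    by (subst filterlim_sequentially_Suc[symmetric],
        rule filterlim_at_top_mono[OF filterlim_real_sequentially]) (simp add: L_Suc)
  define f where "f n x = K ^ n *\<^sub>R \<sigma> (x /\<^sub>R R n)" for n x
  have f_diff: "norm (f n a - f n b) = K ^ n * dist (\<sigma> (a /\<^sub>R R n)) (\<sigma> (b /\<^sub>R R n))" for n a b
    using K by (simp add: f_def dist_norm flip: scaleR_diff_right)
  have dist_R: "dist (a /\<^sub>R R n) (b /\<^sub>R R n) = dist a b / R n" for a b :: 'x and n
    using R[of n] by (simp add: dist_norm divide_inverse mult.commute flip: scaleR_diff_right)
  have "multiscale f (\<lambda>n. 2 * K ^ n) L"
  proof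
    fix n and a b :: 'x
    have "norm (\<sigma> x) \<le> 1" for x
      using assms(1) by (auto simp: image_subset_iff)
    then have "dist (\<sigma> (a /\<^sub>R R n)) (\<sigma> (b /\<^sub>R R n)) \<le> 2"
      by (smt (verit) dist_norm norm_triangle_ineq4)
    then show "norm (f n a - f n b) \<le> 2 * K ^ n"
      using K by (simp add: f_diff mult.commute)
    assume "dist a b \<le> L n"
    then have "dist (a /\<^sub>R R n) (b /\<^sub>R R n) \<le> \<eta> n"
      unfolding dist_R using R[of n] by (simp add: L_def field_simps)
    from small[OF this] show "norm (f n a - f n b) \<le> (1/2) ^ n"
      using K by (simp add: f_diff field_simps)
  next
    fix n
    have "(x::'x) = (R n *\<^sub>R x) /\<^sub>R R n" for x
      using R[of n] by simp
    then have range: "range (\<lambda>x::'x. x /\<^sub>R R n) = UNIV"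
      by (rule surjI[OF sym])
    have "uniformly_continuous_on UNIV (\<lambda>x. \<sigma> (x /\<^sub>R R n))"
    proof (rule uniformly_continuous_on_compose[where f = \<sigma>])
      show "uniformly_continuous_on UNIV (\<lambda>x::'x. x /\<^sub>R R n)"
        by (rule uniformly_continuous_on_cmul[OF uniformly_continuous_on_id])
      show "uniformly_continuous_on (range (\<lambda>x::'x. x /\<^sub>R R n)) \<sigma>"
        using assms(2) range by simp
    qed
    then show "uniformly_continuous_on UNIV (f n)"
      unfolding f_def by (rule uniformly_continuous_on_cmul)
  next
    show "incseq L"
      using LT by (intro incseq_SucI) (simp add: L_Suc le_max_iff_disj)
  qed (rule L_top)
  then show ?thesis
  proof (rule multiscale_coarse_embedding)
    fix m and a b :: 'x assume "t * R m \<le> dist a b"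
    then have "t \<le> dist (a /\<^sub>R R m) (b /\<^sub>R R m)"
      unfolding dist_R using R[of m] by (simp add: field_simps)
    then have "K ^ m * \<delta> \<le> norm (f m a - f m b)"
      using K sep by (simp add: f_diff)
    moreover have "(\<Sum>n<m. 2 * K ^ n) = 2 * ((K ^ m - 1) / (K - 1))"
      using K by (simp add: geometric_sum flip: sum_distrib_left)
    then have "(\<Sum>n<m. 2 * K ^ n) = \<delta> / 2 * (K ^ m - 1)"
      by (simp add: K_def)
    ultimately show "\<delta> / 2 * K ^ m \<le> norm (f m a - f m b) - (\<Sum>n<m. 2 * K ^ n)"
      using \<delta> by (simp add: algebra_simps)
  next
    show "filterlim (\<lambda>m. \<delta> / 2 * K ^ m) at_top sequentially"
      using \<delta> K by (intro filterlim_tendsto_pos_mult_at_top[OF tendsto_const]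
          filterlim_at_infinity_imp_filterlim_at_top filterlim_realpow_sequentially_gt1) auto
    show "filterlim (\<lambda>m. t * R m) at_top sequentially"
      by (rule filterlim_at_top_mono[OF L_top]) (simp add: LT)
    show "t * R m \<le> L (Suc m)" for m
      by (simp add: L_Suc)
  qed
qed

end
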